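(* Let $X$ be a real finite dimensional normed space with $\dim X\ge 2$, let $K\subset X$ be a pointed closed convex cone with nonempty interior, and let $A\subset X$ be a nonempty closed set such that $A=A+K\subset K\setminus\{0\}$. Assume that $$\forall a,a'\in A,\ a\neq a',\ \forall\lambda\in(0,1):\ \lambda a+(1-\lambda)a'\in\operatorname{int}_K A.$$ Then $A$ is convex, $\sigma_A$ is differentiable on $\operatorname{int}K^{-}$, and $A+(K\setminus\{0\})\subset\operatorname{int}_K A$.
   Context: $X^*$ is the dual of $X$, $\langle x,x^*\rangle:=x^*(x)$. A closed convex cone $K$ is pointed if $K\cap(-K)=\{0\}$. $K^{-}:=\{x^*\in X^*\mid\langle x,x^*\rangle\le0\ \forall x\in K\}$. $\operatorname{int}_K A$ is the interior of $A$ as a subset of $K$ endowed with the induced topology. The support function is $\sigma_A(x^* ):=\sup\{\langle u,x^*\rangle\mid u\in A\}\in(-\infty,+\infty]$ for $x^*\in X^*$. Differentiability may be understood in the Gâteaux or Fréchet sense (they coincide here). *)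

theory Defs
  imports "HOL-Analysis.Analysis"
begin

text \<open>The topological dual of a real normed space \<open>'a\<close> is the normed space \<open>'a \<Rightarrow>\<^sub>L real\<close> of bounded
  linear functionals.\<close>

definition finite_dimensional :: "'a::real_vector itself \<Rightarrow> bool" where
  "finite_dimensional _ \<longleftrightarrow> (\<exists>B::'a set. finite B \<and> span B = UNIV)"

definition pointed :: "'a::real_vector set \<Rightarrow> bool" where
  "pointed K \<longleftrightarrow> K \<inter> uminus ` K = {0}"

definition neg_polar :: "'a::real_normed_vector set \<Rightarrow> ('a \<Rightarrow>\<^sub>L real) set" where
  "neg_polar K = {f. \<forall>x\<in>K. blinfun_apply f x \<le> 0}"

definition support_function :: "'a::real_normed_vector set \<Rightarrow> ('a \<Rightarrow>\<^sub>L real) \<Rightarrow> ereal" where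
  "support_function A f = (SUP u\<in>A. ereal (blinfun_apply f u))"

text \<open>Frechet differentiability of an extended-real-valued function. The first conjunct requires it
  to be finite near \<open>x\<close>: \<^const>\<open>real_of_ereal\<close> maps infinite values to \<open>0\<close>.\<close>

definition ereal_differentiable_at :: "('b::real_normed_vector \<Rightarrow> ereal) \<Rightarrow> 'b \<Rightarrow> bool" where
  "ereal_differentiable_at F x \<longleftrightarrow>
     x \<in> interior {y. \<bar>F y\<bar> \<noteq> \<infinity>} \<and> (\<lambda>y. real_of_ereal (F y)) differentiable (at x)"

end

theory Submission
  imports Defs
begin

text \<open>
  Convexity of \<open>A\<close> is the hypothesis on segments, weakened from the relative interior to \<open>A\<close>. For
  \<open>a \<in> A\<close> and \<open>k \<in> K - {0}\<close> the point \<open>a + k\<close> is the midpoint of the distinct points \<open>a\<close> and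
  \<open>a + 2k\<close> of \<open>A = A + K\<close>, so it lies in the relative interior.

  The substance is differentiability of the support function at \<open>f \<in> interior (neg_polar K)\<close>.
  Such an \<open>f\<close> decays linearly on \<open>K\<close>: \<open>f u \<le> - c * norm u\<close> with \<open>c > 0\<close>
  (\<open>interior_neg_polar_coercive\<close>). Since \<open>A\<close> lies in \<open>K\<close>, this confines the relevant part of \<open>A\<close>
  to a compact set, and \<open>f\<close> attains its maximum over \<open>A\<close>. The maximiser \<open>u\<close> is unique: two maximisers
  would have a midpoint that is again a maximiser and lies in the relative interior of \<open>A\<close>, but there one
  can move a little towards \<open>0\<close> inside \<open>K\<close>, which increases \<open>f\<close> because \<open>f\<close> is negative on
  \<open>K - {0}\<close> (\<open>unique_maximiser\<close>). Functionals near \<open>f\<close> have the same decay with constant \<open>c / 2\<close>, and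
  by compactness their maximisers are close to \<open>u\<close> (\<open>maximisers_near_unique_maximiser\<close>). If \<open>v\<close>
  maximises \<open>g\<close> over \<open>A\<close>, then comparing \<open>u\<close> and \<open>v\<close> as competitors gives
  \<open>0 \<le> \<sigma> g - \<sigma> f - (g - f) u \<le> (g - f) (v - u)\<close>, where \<open>\<sigma>\<close> is the support function of \<open>A\<close>.
  The upper bound is at most \<open>norm (g - f) * norm (v - u)\<close>, hence \<open>o (norm (g - f))\<close>. So evaluation
  at \<open>u\<close> is the Frechet derivative.

  The space is an arbitrary finite-dimensional normed space, so local compactness and the existence of
  enough bounded functionals are derived first, both from the fact that the distance of a point to a closed
  subspace not containing it is positive.
\<close>

section \<open>Finite-dimensional normed spaces\<close>

text \<open>The constant is the radius of a ball around \<open>b\<close> that misses \<open>S\<close>; dividing by \<open>c\<close> reduces the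
  estimate to the case \<open>c = 1\<close>.\<close>

lemma coefficient_bound_closed_subspace:
  fixes S :: "'a::real_normed_vector set"
  assumes S: "subspace S" "closed S" and b: "b \<notin> S"
  obtains d where "d > 0" "\<And>c y. y \<in> S \<Longrightarrow> d * \<bar>c\<bar> \<le> norm (c *\<^sub>R b + y)"
proof -
  have "open (- S)" "b \<in> - S"
    using S b by auto
  then obtain d where d: "d > 0" "ball b d \<subseteq> - S"
    using open_contains_ball by blast
  have "d * \<bar>c\<bar> \<le> norm (c *\<^sub>R b + y)" if y: "y \<in> S" for c y
  proof (cases "c = 0")
    case False
    have "- (y /\<^sub>R c) \<in> S"
      using y S(1) by (simp add: subspace_scale subspace_neg)
    then have "d \<le> dist b (- (y /\<^sub>R c))"
      using d(2) by (meson ComplD in_mono mem_ball not_le)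
    then have "d \<le> norm (b + y /\<^sub>R c)"
      by (simp add: dist_norm)
    then have "d * \<bar>c\<bar> \<le> \<bar>c\<bar> * norm (b + y /\<^sub>R c)"
      by (subst mult.commute) (rule mult_left_mono, auto)
    also have "\<dots> = norm (c *\<^sub>R (b + y /\<^sub>R c))"
      by simp
    also have "c *\<^sub>R (b + y /\<^sub>R c) = c *\<^sub>R b + y"
      using False by (simp add: scaleR_add_right)
    finally show ?thesis .
  qed simp
  with d(1) that show thesis by blast
qed

lemma closed_if_bounded_sequences_subconverge:
  fixes S :: "'a::real_normed_vector set"
  assumes "\<And>x. range x \<subseteq> S \<Longrightarrow> bounded (range x) \<Longrightarrow>
    \<exists>l\<in>S. \<exists>r::nat\<Rightarrow>nat. strict_mono r \<and> (x \<circ> r) \<longlonglongrightarrow> l"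
  shows "closed S"
  unfolding closed_sequential_limits
proof (intro allI impI)
  fix x l
  assume x: "(\<forall>n. x n \<in> S) \<and> x \<longlonglongrightarrow> l"
  then have "range x \<subseteq> S" "bounded (range x)"
    by (auto intro: convergent_imp_bounded)
  with assms obtain l' r where l': "l' \<in> S" "strict_mono r" "(x \<circ> r) \<longlonglongrightarrow> l'" by blast
  have "(x \<circ> r) \<longlonglongrightarrow> l"
    using x l'(2) by (intro LIMSEQ_subseq_LIMSEQ) auto
  with l' show "l \<in> S"
    using LIMSEQ_unique by blast
qed

text \<open>Bolzano--Weierstrass in the span of a finite set, by induction on the set. Adding a new vector \<open>b\<close>
  to \<open>B\<close>, the previous case shows that \<open>span B\<close> is closed, so the coefficients of \<open>b\<close> along
  a bounded sequence are bounded, and so are the remaining components.\<close>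

lemma bounded_sequence_finite_span:
  fixes B :: "'a::real_normed_vector set"
  assumes "finite B" "range x \<subseteq> span B" "bounded (range x)"
  shows "\<exists>l\<in>span B. \<exists>r::nat\<Rightarrow>nat. strict_mono r \<and> (x \<circ> r) \<longlonglongrightarrow> l"
  using assms
proof (induction B arbitrary: x rule: finite_induct)
  case empty
  then have "x = (\<lambda>n. 0)" by auto
  then show ?case
    by (auto simp: o_def intro!: exI[of _ id] strict_mono_id)
next
  case (insert b B)
  show ?case
  proof (cases "b \<in> span B")
    case True
    then have "span (insert b B) = span B" by (rule span_redundant)
    with insert.IH[of x] insert.prems show ?thesis by simp
  next
    case False
    have "closed (span B)"
      using insert.IH by (rule closed_if_bounded_sequences_subconverge)
    then obtain d where d: "d > 0" "\<And>c y. y \<in> span B \<Longrightarrow> d * \<bar>c\<bar> \<le> norm (c *\<^sub>R b + y)"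
      using coefficient_bound_closed_subspace[OF subspace_span _ False] by blast
    have "\<exists>c. x n - c *\<^sub>R b \<in> span B" for n
      using insert.prems(1) span_breakdown_eq[of "x n" b B] by auto
    then obtain c where c: "\<And>n. x n - c n *\<^sub>R b \<in> span B" by metis
    obtain M where M: "\<And>n. norm (x n) \<le> M"
      using insert.prems(2) by (auto simp: bounded_iff)
    have cM: "\<bar>c n\<bar> \<le> M / d" for n
    proof -
      have "d * \<bar>c n\<bar> \<le> norm (x n)"
        using d(2)[OF c[of n], of "c n"] by simp
      also have "\<dots> \<le> M" by (rule M)
      finally show ?thesis
        using d(1) by (simp add: field_simps)
    qed
    then have "bounded (range c)"
      by (auto simp: bounded_iff)
    then obtain a r where r: "strict_mono r" "(c \<circ> r) \<longlonglongrightarrow> a"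
      using bounded_imp_convergent_subsequence by blast
    let ?y = "\<lambda>n. x (r n) - c (r n) *\<^sub>R b"
    have "norm (?y n) \<le> M + M / d * norm b" for n
    proof -
      have "norm (?y n) \<le> norm (x (r n)) + norm (c (r n) *\<^sub>R b)"
        by (rule norm_triangle_ineq4)
      also have "\<dots> \<le> M + M / d * norm b"
        using M[of "r n"] mult_right_mono[OF cM[of "r n"] norm_ge_zero[of b]] by simp
      finally show ?thesis .
    qed
    then have "bounded (range ?y)"
      by (auto simp: bounded_iff)
    then obtain l s where s: "l \<in> span B" "strict_mono s" "(?y \<circ> s) \<longlonglongrightarrow> l"
      using insert.IH[of ?y] c by blast
    have cs: "((c \<circ> r) \<circ> s) \<longlonglongrightarrow> a"
      using LIMSEQ_subseq_LIMSEQ[OF r(2) s(2)] .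
    have "(\<lambda>n. (?y \<circ> s) n + ((c \<circ> r) \<circ> s) n *\<^sub>R b) \<longlonglongrightarrow> l + a *\<^sub>R b"
      by (intro tendsto_intros s(3) cs)
    then have "(x \<circ> (r \<circ> s)) \<longlonglongrightarrow> l + a *\<^sub>R b"
      by (simp add: o_def)
    moreover have "l + a *\<^sub>R b \<in> span (insert b B)"
      using s(1) span_breakdown_eq[of "l + a *\<^sub>R b" b B] by (metis add_diff_cancel_right')
    moreover have "strict_mono (r \<circ> s)"
      using r(1) s(2) by (rule strict_mono_o)
    ultimately show ?thesis by blast
  qed
qed

lemma finite_dimensional_compact_iff:
  fixes S :: "'a::real_normed_vector set"
  assumes "finite_dimensional TYPE('a)"
  shows "compact S \<longleftrightarrow> closed S \<and> bounded S"
proof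
  assume S: "closed S \<and> bounded S"
  from assms obtain B :: "'a set" where B: "finite B" "span B = UNIV"
    unfolding finite_dimensional_def by blast
  show "compact S"
    unfolding compact_eq_seq_compact_metric seq_compact_def
  proof (intro allI impI)
    fix x :: "nat \<Rightarrow> 'a"
    assume x: "\<forall>n. x n \<in> S"
    then have "bounded (range x)"
      using S by (metis bounded_subset image_subsetI)
    then obtain l r where l: "strict_mono r" "(x \<circ> r) \<longlonglongrightarrow> l"
      using bounded_sequence_finite_span[OF B(1), of x] B(2) by auto
    moreover have "l \<in> S"
      using S l(2) x closed_sequentially[of S "x \<circ> r" l] by simp
    ultimately show "\<exists>l\<in>S. \<exists>r. strict_mono r \<and> (x \<circ> r) \<longlonglongrightarrow> l" by blast
  qed
qed (auto intro: compact_imp_closed compact_imp_bounded)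

text \<open>The functional is the coordinate of \<open>u\<close> in a basis containing \<open>u\<close>; it is bounded because the other
  basis vectors span a closed subspace.\<close>

lemma finite_dimensional_separating_functional:
  fixes u :: "'a::real_normed_vector"
  assumes fd: "finite_dimensional TYPE('a)" and u: "u \<noteq> 0"
  obtains g :: "'a \<Rightarrow>\<^sub>L real" where "blinfun_apply g u = 1"
proof -
  have "independent {u}"
    using u by simp
  then obtain C where "{u} \<subseteq> C" "independent C" "UNIV \<subseteq> span C"
    by (rule maximal_independent_subset_extend[OF subset_UNIV])
  then have C: "u \<in> C" "independent C" "span C = UNIV"
    by blast+
  obtain B :: "'a set" where B: "finite B" "span B = UNIV"
    using fd unfolding finite_dimensional_def by blast
  have "finite C"
    using independent_span_bound[OF B(1) C(2)] B(2) by simp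
  define D where "D = C - {u}"
  have D: "finite D" "u \<notin> span D" "insert u D = C"
    using \<open>finite C\<close> C(1,2) by (auto simp: D_def dependent_def)
  have "closed (span D)"
    using bounded_sequence_finite_span[OF D(1)]
    by (rule closed_if_bounded_sequences_subconverge)
  then obtain d where d: "d > 0" "\<And>c y. y \<in> span D \<Longrightarrow> d * \<bar>c\<bar> \<le> norm (c *\<^sub>R u + y)"
    using coefficient_bound_closed_subspace[OF subspace_span _ D(2)] by blast
  obtain h :: "'a \<Rightarrow> real" where h: "linear h" "\<forall>x\<in>C. h x = (if x = u then 1 else 0)"
    using linear_independent_extend[OF C(2), of "\<lambda>x. if x = u then 1 else 0"] by blast
  have hu: "h u = 1"
    using h(2) C(1) by simp
  have h0: "h y = 0" if "y \<in> span D" for y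
    using linear_eq_0_on_span[OF h(1) _ that] h(2) by (auto simp: D_def)
  have "\<bar>h x\<bar> \<le> norm x * (1 / d)" for x
  proof -
    have "x \<in> span (insert u D)"
      using C(3) D(3) by simp
    then obtain k where k: "x - k *\<^sub>R u \<in> span D"
      using span_breakdown_eq[of x u D] by blast
    have "h x = k"
      using h0[OF k] hu by (simp add: linear_diff[OF h(1)] linear_scale[OF h(1)])
    then show ?thesis
      using d(1) d(2)[OF k, of k] by (simp add: field_simps)
  qed
  then have "bounded_linear h"
    using h(1) by (intro bounded_linear_intro[of _ "1 / d"]) (auto simp: linear_add linear_scale)
  with hu that[of "Blinfun h"] show thesis
    by (simp add: bounded_linear_Blinfun_apply)
qed

section \<open>Functionals in the interior of the polar cone\<close>

text \<open>By homogeneity and compactness of the unit sphere of \<open>K\<close> only strict negativity on the unit vectors of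
  \<open>K\<close> is at stake. If \<open>f\<close> vanished at such a vector \<open>u\<close>, then adding to \<open>f\<close> a small multiple of a
  functional positive at \<open>u\<close> would leave the polar cone.\<close>

lemma interior_neg_polar_coercive:
  fixes K :: "'a::real_normed_vector set"
  assumes fd: "finite_dimensional TYPE('a)" and K: "conic K" "closed K"
    and f: "f \<in> interior (neg_polar K)"
  obtains c where "c > 0" "\<And>u. u \<in> K \<Longrightarrow> blinfun_apply f u \<le> - c * norm u"
proof -
  have neg: "blinfun_apply f u < 0" if u: "u \<in> K" "u \<noteq> 0" for u
  proof -
    obtain g :: "'a \<Rightarrow>\<^sub>L real" where g: "blinfun_apply g u = 1"
      using finite_dimensional_separating_functional[OF fd u(2)] .
    obtain e where e: "e > 0" "cball f e \<subseteq> neg_polar K"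
      using f mem_interior_cball by blast
    define t where "t = e / (norm g + 1)"
    have pos: "norm g + 1 > 0"
      by (simp add: add_nonneg_pos)
    then have t: "t > 0"
      using e(1) by (simp add: t_def)
    have "norm (t *\<^sub>R g) \<le> e"
      using pos e(1) by (simp add: t_def field_simps)
    then have "f + t *\<^sub>R g \<in> neg_polar K"
      using e(2) by (auto simp: dist_norm)
    then have "blinfun_apply f u + t \<le> 0"
      using u(1) g by (auto simp: neg_polar_def blinfun.add_left blinfun.scaleR_left)
    with t show ?thesis by simp
  qed
  define S where "S = K \<inter> {u. norm u = 1}"
  have "compact S"
    unfolding finite_dimensional_compact_iff[OF fd] S_def
    by (auto intro!: closed_Int K(2) closed_Collect_eq continuous_intros simp: bounded_iff)
  moreover have "continuous_on S (blinfun_apply f)"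
    by (intro continuous_intros)
  ultimately obtain c where c: "c > 0" "\<And>u. u \<in> S \<Longrightarrow> blinfun_apply f u \<le> - c"
  proof (cases "S = {}")
    case True
    with that[of 1] show ?thesis by simp
  next
    case False
    assume "compact S" "continuous_on S (blinfun_apply f)"
    with False obtain w where w: "w \<in> S" "\<And>u. u \<in> S \<Longrightarrow> blinfun_apply f u \<le> blinfun_apply f w"
      using continuous_attains_sup by metis
    have "blinfun_apply f w < 0"
      using w(1) by (intro neg) (auto simp: S_def)
    with w(2) that[of "- blinfun_apply f w"] show ?thesis by simp
  qed
  have "blinfun_apply f u \<le> - c * norm u" if u: "u \<in> K" for u
  proof (cases "u = 0")
    case False
    then have "u /\<^sub>R norm u \<in> S"
      using K(1) u by (auto simp: S_def conic_def)
    from c(2)[OF this] False show ?thesis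
      by (simp add: blinfun.scaleR_right field_simps)
  qed simp
  with c(1) that show thesis by blast
qed

text \<open>The decay of \<open>g\<close> makes its superlevel sets in \<open>A\<close> bounded, hence compact.\<close>

lemma coercive_attains_max:
  fixes A :: "'a::real_normed_vector set" and g :: "'a \<Rightarrow>\<^sub>L real"
  assumes fd: "finite_dimensional TYPE('a)" and A: "closed A" "A \<noteq> {}"
    and c: "c > 0" "\<And>u. u \<in> A \<Longrightarrow> blinfun_apply g u \<le> - c * norm u"
  obtains v where "v \<in> A" "\<And>u. u \<in> A \<Longrightarrow> blinfun_apply g u \<le> blinfun_apply g v"
proof -
  obtain a where a: "a \<in> A" using A(2) by blast
  define S where "S = A \<inter> {u. blinfun_apply g a \<le> blinfun_apply g u}"
  have "norm u \<le> - blinfun_apply g a / c" if "u \<in> S" for u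
    using that c(2)[of u] c(1) by (auto simp: S_def field_simps)
  then have "bounded S"
    by (auto simp: bounded_iff)
  moreover have "closed S"
    unfolding S_def by (intro closed_Int A(1) closed_Collect_le continuous_intros)
  ultimately have "compact S"
    using finite_dimensional_compact_iff[OF fd] by blast
  moreover have "S \<noteq> {}" "continuous_on S (blinfun_apply g)"
    using a by (auto simp: S_def intro!: continuous_intros)
  ultimately obtain v where v: "v \<in> S" "\<And>u. u \<in> S \<Longrightarrow> blinfun_apply g u \<le> blinfun_apply g v"
    using continuous_attains_sup by metis
  have "blinfun_apply g u \<le> blinfun_apply g v" if "u \<in> A" for u
  proof (cases "u \<in> S")
    case False
    with that have "blinfun_apply g u < blinfun_apply g a" by (simp add: S_def)
    also have "\<dots> \<le> blinfun_apply g v" using v(1) by (simp add: S_def)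
    finally show ?thesis by simp
  qed (rule v(2))
  with v(1) that show thesis by (auto simp: S_def)
qed

section \<open>Uniqueness and stability of maximisers\<close>

text \<open>Shrinking a relative interior point \<open>m\<close> of \<open>A\<close> slightly towards \<open>0\<close> stays in \<open>K\<close>, hence in
  \<open>A\<close>, and increases \<open>f\<close> if \<open>f m < 0\<close>.\<close>

lemma relative_interior_point_not_maximal:
  fixes K A :: "'a::real_normed_vector set" and f :: "'a \<Rightarrow>\<^sub>L real"
  assumes K: "conic K" and m: "m \<in> top_of_set K interior_of A" and fm: "blinfun_apply f m < 0"
  obtains u where "u \<in> A" "blinfun_apply f m < blinfun_apply f u"
proof -
  obtain T where T: "openin (top_of_set K) T" "m \<in> T" "T \<subseteq> A"
    using m by (auto simp: interior_of_def)
  then have mK: "m \<in> K" and "\<exists>e>0. ball m e \<inter> K \<subseteq> T"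
    unfolding openin_contains_ball by blast+
  then obtain e where e: "e > 0" "ball m e \<inter> K \<subseteq> T" by blast
  have mpos: "norm m + 1 > 0"
    by (simp add: add_nonneg_pos)
  \<comment> \<open>Scaling by \<open>1 - s\<close> moves \<open>m\<close> by \<open>s * norm m < e\<close>.\<close>
  define s where "s = min 1 (e / (norm m + 1))"
  have s: "0 < s" "s \<le> 1"
    using e(1) mpos by (auto simp: s_def)
  have "s * norm m < s * (norm m + 1)"
    using s(1) by simp
  also have "\<dots> \<le> e / (norm m + 1) * (norm m + 1)"
    using mpos by (intro mult_right_mono) (auto simp: s_def)
  also have "\<dots> = e"
    using mpos by simp
  finally have "s * norm m < e" .
  moreover have "m - (1 - s) *\<^sub>R m = s *\<^sub>R m"
    by (simp add: algebra_simps)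
  ultimately have "(1 - s) *\<^sub>R m \<in> ball m e"
    using s by (simp add: dist_norm)
  moreover have "(1 - s) *\<^sub>R m \<in> K"
    using K mK s by (simp add: conic_def)
  ultimately have "(1 - s) *\<^sub>R m \<in> A"
    using e(2) T(3) by blast
  moreover have "blinfun_apply f m < blinfun_apply f ((1 - s) *\<^sub>R m)"
    using mult_strict_left_mono[OF fm s(1)] by (simp add: blinfun.scaleR_right left_diff_distrib)
  ultimately show thesis using that by blast
qed

lemma unique_maximiser:
  fixes K A :: "'a::real_normed_vector set" and f :: "'a \<Rightarrow>\<^sub>L real"
  assumes K: "conic K" and neg: "\<And>u. u \<in> A \<Longrightarrow> blinfun_apply f u < 0"
    and strict: "\<And>a a'. a \<in> A \<Longrightarrow> a' \<in> A \<Longrightarrow> a \<noteq> a' \<Longrightarrow>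
      (1/2) *\<^sub>R a + (1/2) *\<^sub>R a' \<in> top_of_set K interior_of A"
    and u: "u \<in> A" "\<And>w. w \<in> A \<Longrightarrow> blinfun_apply f w \<le> blinfun_apply f u"
    and v: "v \<in> A" "blinfun_apply f v = blinfun_apply f u"
  shows "v = u"
proof (rule ccontr)
  assume "v \<noteq> u"
  let ?m = "(1/2) *\<^sub>R v + (1/2) *\<^sub>R u"
  have m: "?m \<in> top_of_set K interior_of A"
    using strict[OF v(1) u(1) \<open>v \<noteq> u\<close>] .
  have fm: "blinfun_apply f ?m = blinfun_apply f u"
    using v(2) by (simp add: blinfun.add_right blinfun.scaleR_right)
  then have "blinfun_apply f ?m < 0"
    using neg[OF u(1)] by simp
  then obtain w where "w \<in> A" "blinfun_apply f ?m < blinfun_apply f w"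
    using relative_interior_point_not_maximal[OF K m] by blast
  with u(2)[of w] fm show False by simp
qed

text \<open>Maximisers of all \<open>g\<close> near \<open>f\<close> lie in one ball of radius \<open>R\<close>. By compactness, \<open>f\<close> falls short of
  its maximum by at least some \<open>\<eta> > 0\<close> on the points of \<open>A\<close> in that ball at distance at least \<open>e\<close> from
  \<open>u\<close>, whereas a maximiser of \<open>g\<close> falls short by at most \<open>norm (g - f)\<close> times
  the diameter of the ball.\<close>

lemma maximisers_near_unique_maximiser:
  fixes A :: "'a::real_normed_vector set" and f :: "'a \<Rightarrow>\<^sub>L real"
  assumes fd: "finite_dimensional TYPE('a)" and A: "closed A"
    and c: "c > 0" "\<And>w. w \<in> A \<Longrightarrow> blinfun_apply f w \<le> - c * norm w"
    and u: "u \<in> A" "\<And>w. w \<in> A \<Longrightarrow> blinfun_apply f w \<le> blinfun_apply f u"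
    and unique: "\<And>w. w \<in> A \<Longrightarrow> blinfun_apply f w = blinfun_apply f u \<Longrightarrow> w = u"
    and e: "e > 0"
  obtains d where "d > 0"
    "\<And>g v. norm (g - f) < d \<Longrightarrow> v \<in> A \<Longrightarrow>
      (\<And>w. w \<in> A \<Longrightarrow> blinfun_apply g w \<le> blinfun_apply g v) \<Longrightarrow> norm (v - u) < e"
proof -
  \<comment> \<open>The first summand bounds the maximisers: if \<open>norm (g - f) \<le> c / 2\<close> and \<open>v\<close> maximises \<open>g\<close>, then
    \<open>c / 2 * norm v \<le> - g v \<le> - g u \<le> (norm f + c) * norm u\<close>. The others keep \<open>u\<close> in the ball and
    \<open>R\<close> positive.\<close>
  define R where "R = 2 / c * ((norm f + c) * norm u) + norm u + 1"
  have R1: "R \<ge> norm u + 1" and R2: "2 / c * ((norm f + c) * norm u) \<le> R"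
    using c(1) by (auto simp: R_def intro!: mult_nonneg_nonneg add_nonneg_nonneg)
  have R0: "R > 0" using R1 norm_ge_zero[of u] by linarith
  \<comment> \<open>The points a maximiser has to avoid; \<open>S\<close> may be empty, and then any \<open>\<eta>\<close> will do.\<close>
  define S where "S = A \<inter> cball 0 R - ball u e"
  have "compact S"
    unfolding finite_dimensional_compact_iff[OF fd] S_def using A
    by (auto simp: closed_Int closed_Diff intro: bounded_subset[OF bounded_cball[of 0 R]])
  moreover have "continuous_on S (blinfun_apply f)"
    by (intro continuous_intros)
  ultimately obtain \<eta> where eta: "\<eta> > 0" "\<And>w. w \<in> S \<Longrightarrow> blinfun_apply f w \<le> blinfun_apply f u - \<eta>"
  proof (cases "S = {}")
    case True
    with that[of 1] show ?thesis by simp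
  next
    case False
    assume "compact S" "continuous_on S (blinfun_apply f)"
    with False obtain w where w: "w \<in> S" "\<And>z. z \<in> S \<Longrightarrow> blinfun_apply f z \<le> blinfun_apply f w"
      using continuous_attains_sup by metis
    have "w \<in> A" "w \<noteq> u"
      using w(1) e by (auto simp: S_def)
    then have "blinfun_apply f w < blinfun_apply f u"
      using u(2) unique by (metis order_le_less)
    with w(2) that[of "blinfun_apply f u - blinfun_apply f w"] show ?thesis by simp
  qed
  \<comment> \<open>Since \<open>norm (v - u) \<le> 2 * R\<close>, the second bound keeps the loss in \<open>f\<close> below \<open>\<eta>\<close>.\<close>
  define d where "d = min (c / 2) (\<eta> / (2 * R))"
  have d: "d > 0" "d \<le> c / 2" "d * (2 * R) \<le> \<eta>"
  proof -
    show "d > 0" using c(1) eta(1) R0 by (simp add: d_def)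
    show "d \<le> c / 2" by (simp add: d_def)
    have "d \<le> \<eta> / (2 * R)" by (simp add: d_def)
    then show "d * (2 * R) \<le> \<eta>" using R0 by (simp add: field_simps)
  qed
  have "norm (v - u) < e"
    if g: "norm (g - f) < d" and v: "v \<in> A"
      and max: "\<And>w. w \<in> A \<Longrightarrow> blinfun_apply g w \<le> blinfun_apply g v" for g v
  proof -
    have diff: "\<bar>blinfun_apply g w - blinfun_apply f w\<bar> \<le> norm (g - f) * norm w" for w
      using norm_blinfun[of "g - f" w] by (simp add: blinfun.diff_left)
    have half: "norm (g - f) * norm w \<le> c / 2 * norm w" for w :: 'a
      using g d(2) by (intro mult_right_mono) auto
    have "c / 2 * norm v \<le> - blinfun_apply g v"
      using diff[of v] half[of v] c(2)[OF v] by simp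
    also have "\<dots> \<le> - blinfun_apply g u"
      using max[OF u(1)] by simp
    also have "\<dots> \<le> (norm f + c) * norm u"
    proof -
      have "\<bar>blinfun_apply f u\<bar> \<le> norm f * norm u"
        using norm_blinfun[of f u] by simp
      moreover have "c / 2 * norm u \<le> c * norm u"
        using c(1) by (intro mult_right_mono) auto
      ultimately show ?thesis
        using diff[of u] half[of u] by (simp add: distrib_right)
    qed
    finally have "norm v \<le> 2 / c * ((norm f + c) * norm u)"
      using c(1) by (simp add: field_simps)
    then have vR: "norm v \<le> R"
      using R2 by linarith
    have "blinfun_apply f u - blinfun_apply f v \<le> blinfun_apply (g - f) (v - u)"
      using max[OF u(1)] by (simp add: blinfun.diff_left blinfun.diff_right)
    also have "\<dots> \<le> norm (g - f) * norm (v - u)"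
      using norm_blinfun[of "g - f" "v - u"] by simp
    also have "\<dots> \<le> norm (g - f) * (2 * R)"
      using vR R1 norm_triangle_ineq4[of v u] by (intro mult_left_mono) auto
    also have "\<dots> < d * (2 * R)"
      using g R0 by simp
    finally have "blinfun_apply f u - blinfun_apply f v < \<eta>"
      using d(3) by simp
    then have "v \<notin> S"
      using eta(2)[of v] by auto
    then show ?thesis
      using v vR by (simp add: S_def dist_norm norm_minus_commute)
  qed
  with d(1) that show thesis by blast
qed

section \<open>Differentiability of the support function\<close>

lemma support_function_attained:
  assumes "v \<in> A" "\<And>w. w \<in> A \<Longrightarrow> blinfun_apply g w \<le> blinfun_apply g v"
  shows "support_function A g = ereal (blinfun_apply g v)"
  unfolding support_function_def using assms
  by (intro antisym SUP_least SUP_upper2[of v]) auto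

text \<open>The derivative at \<open>f\<close> is evaluation at the maximiser of \<open>f\<close>.\<close>

lemma support_function_has_derivative:
  fixes A :: "'a::real_normed_vector set"
  assumes fd: "finite_dimensional TYPE('a)" and A: "closed A"
    and c: "c > 0" "\<And>w. w \<in> A \<Longrightarrow> blinfun_apply f w \<le> - c * norm w"
    and u: "u \<in> A" "\<And>w. w \<in> A \<Longrightarrow> blinfun_apply f w \<le> blinfun_apply f u"
    and unique: "\<And>w. w \<in> A \<Longrightarrow> blinfun_apply f w = blinfun_apply f u \<Longrightarrow> w = u"
  shows "((\<lambda>g. real_of_ereal (support_function A g)) has_derivative (\<lambda>h. blinfun_apply h u)) (at f)"
  unfolding has_derivative_at_alt
proof (intro conjI allI impI)
  show "bounded_linear (\<lambda>h. blinfun_apply h u)"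
    by (rule blinfun.bounded_linear_left)
  fix e :: real
  assume e: "e > 0"
  obtain d where d: "d > 0"
    "\<And>g v. norm (g - f) < d \<Longrightarrow> v \<in> A \<Longrightarrow>
      (\<And>w. w \<in> A \<Longrightarrow> blinfun_apply g w \<le> blinfun_apply g v) \<Longrightarrow> norm (v - u) < e"
    using maximisers_near_unique_maximiser[OF fd A c u unique e] by blast
  have "norm (real_of_ereal (support_function A g) - real_of_ereal (support_function A f)
      - blinfun_apply (g - f) u) \<le> e * norm (g - f)"
    if g: "norm (g - f) < min d (c / 2)" for g
  proof -
    have "blinfun_apply g w \<le> - (c / 2) * norm w" if w: "w \<in> A" for w
    proof -
      have "blinfun_apply g w - blinfun_apply f w \<le> norm (g - f) * norm w"
        using norm_blinfun[of "g - f" w] by (simp add: blinfun.diff_left)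
      also have "\<dots> \<le> c / 2 * norm w"
        using g by (intro mult_right_mono) auto
      finally show ?thesis
        using c(2)[OF w] by simp
    qed
    then obtain v where v: "v \<in> A" "\<And>w. w \<in> A \<Longrightarrow> blinfun_apply g w \<le> blinfun_apply g v"
      using coercive_attains_max[OF fd A, of "c / 2" g] u(1) c(1) by (metis empty_iff half_gt_zero)
    let ?r = "blinfun_apply g v - blinfun_apply f u - blinfun_apply (g - f) u"
    have "0 \<le> ?r"
      using v(2)[OF u(1)] by (simp add: blinfun.diff_left)
    moreover have "?r \<le> blinfun_apply (g - f) (v - u)"
      using u(2)[OF v(1)] by (simp add: blinfun.diff_left blinfun.diff_right)
    moreover have "blinfun_apply (g - f) (v - u) \<le> norm (g - f) * norm (v - u)"
      using norm_blinfun[of "g - f" "v - u"] by simp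
    moreover have "norm (g - f) * norm (v - u) \<le> norm (g - f) * e"
      using d(2)[OF _ v] g by (intro mult_left_mono) (auto intro: less_imp_le)
    ultimately have "\<bar>?r\<bar> \<le> e * norm (g - f)"
      by (simp add: mult.commute)
    then show ?thesis
      using support_function_attained[OF v] support_function_attained[OF u] by simp
  qed
  then show "\<exists>d>0. \<forall>g. norm (g - f) < d \<longrightarrow>
      norm (real_of_ereal (support_function A g) - real_of_ereal (support_function A f)
        - blinfun_apply (g - f) u) \<le> e * norm (g - f)"
    using d(1) c(1) by (intro exI[of _ "min d (c / 2)"]) auto
qed

lemma support_function_finite_on_neg_polar:
  assumes "A \<noteq> {}" "A \<subseteq> K" "g \<in> neg_polar K"
  shows "\<bar>support_function A g\<bar> \<noteq> \<infinity>"
proof -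
  obtain a where a: "a \<in> A" using assms(1) by blast
  have "support_function A g \<le> 0"
    unfolding support_function_def using assms(2,3)
    by (intro SUP_least) (auto simp: neg_polar_def)
  moreover have "ereal (blinfun_apply g a) \<le> support_function A g"
    unfolding support_function_def using a by (intro SUP_upper)
  ultimately show ?thesis by auto
qed

theorem proposition16:
  fixes K A :: "'a::real_normed_vector set"
  assumes "finite_dimensional TYPE('a)"
    and "dim (UNIV :: 'a set) \<ge> 2"
    and "convex_cone K" and "closed K" and "pointed K" and "interior K \<noteq> {}"
    and "A \<noteq> {}" and "closed A"
    and "A = A + K" and "A + K \<subseteq> K - {0}"
    and "\<forall>a\<in>A. \<forall>a'\<in>A. a \<noteq> a' \<longrightarrow>
           (\<forall>t\<in>{0<..<1::real}. t *\<^sub>R a + (1 - t) *\<^sub>R a' \<in> top_of_set K interior_of A)"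
  shows "convex A
    \<and> (\<forall>f \<in> interior (neg_polar K). ereal_differentiable_at (support_function A) f)
    \<and> A + (K - {0}) \<subseteq> top_of_set K interior_of A"
proof -
  note fd = assms(1)
  have K: "conic K"
    using assms(3) by (simp add: convex_cone_def)
  have AK: "A \<subseteq> K - {0}"
    using assms(9,10) by simp
  have segment: "t *\<^sub>R a + (1 - t) *\<^sub>R a' \<in> top_of_set K interior_of A"
    if "a \<in> A" "a' \<in> A" "a \<noteq> a'" "0 < t" "t < 1" for a a' t
    using assms(11) that by simp
  have midpoint: "(1/2) *\<^sub>R a + (1/2) *\<^sub>R a' \<in> top_of_set K interior_of A"
    if "a \<in> A" "a' \<in> A" "a \<noteq> a'" for a a'
    using segment[OF that, of "1/2"] by simp
  have "convex A"
    unfolding convex_alt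
  proof (intro ballI allI impI)
    fix x y t
    assume xy: "x \<in> A" "y \<in> A" and t: "0 \<le> t \<and> t \<le> (1::real)"
    show "(1 - t) *\<^sub>R x + t *\<^sub>R y \<in> A"
    proof (cases "x = y \<or> t = 0 \<or> t = 1")
      case True
      then show ?thesis
        using xy by (auto simp: algebra_simps)
    next
      case False
      then have "(1 - t) *\<^sub>R x + t *\<^sub>R y \<in> top_of_set K interior_of A"
        using segment[OF xy, of "1 - t"] t by auto
      then show ?thesis
        by (rule subsetD[OF interior_of_subset])
    qed
  qed
  moreover have "ereal_differentiable_at (support_function A) f"
    if f: "f \<in> interior (neg_polar K)" for f
  proof -
    obtain c where c: "c > 0" "\<And>w. w \<in> K \<Longrightarrow> blinfun_apply f w \<le> - c * norm w"
      using interior_neg_polar_coercive[OF fd K assms(4) f] by blast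
    have cA: "blinfun_apply f w \<le> - c * norm w" if "w \<in> A" for w
      using c(2) AK that by blast
    have neg: "blinfun_apply f w < 0" if "w \<in> A" for w
    proof -
      have "w \<noteq> 0"
        using AK that by blast
      then have "c * norm w > 0"
        using c(1) by simp
      with cA[OF that] show ?thesis by simp
    qed
    obtain u where u: "u \<in> A" "\<And>w. w \<in> A \<Longrightarrow> blinfun_apply f w \<le> blinfun_apply f u"
      using coercive_attains_max[OF fd assms(8,7) c(1) cA] by blast
    have "w = u" if "w \<in> A" "blinfun_apply f w = blinfun_apply f u" for w
      using K neg midpoint u that by (rule unique_maximiser)
    with fd assms(8) c(1) cA u
    have "((\<lambda>g. real_of_ereal (support_function A g)) has_derivative (\<lambda>h. blinfun_apply h u)) (at f)"
      by (rule support_function_has_derivative)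
    then have "(\<lambda>g. real_of_ereal (support_function A g)) differentiable (at f)"
      unfolding differentiable_def by blast
    moreover have "neg_polar K \<subseteq> {g. \<bar>support_function A g\<bar> \<noteq> \<infinity>}"
    proof
      fix g
      assume "g \<in> neg_polar K"
      moreover have "A \<subseteq> K"
        using AK by blast
      ultimately show "g \<in> {g. \<bar>support_function A g\<bar> \<noteq> \<infinity>}"
        using support_function_finite_on_neg_polar[OF assms(7)] by simp
    qed
    then have "f \<in> interior {g. \<bar>support_function A g\<bar> \<noteq> \<infinity>}"
      using f interior_mono by blast
    ultimately show ?thesis
      by (simp add: ereal_differentiable_at_def)
  qed
  moreover have "A + (K - {0}) \<subseteq> top_of_set K interior_of A"
  proof
    fix x
    assume "x \<in> A + (K - {0})"
    then obtain a k where x: "x = a + k" and a: "a \<in> A" and k: "k \<in> K" "k \<noteq> 0"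
      unfolding set_plus_def by blast
    have "2 *\<^sub>R k \<in> K"
      using K k(1) by (simp add: conic_def)
    then have "a + 2 *\<^sub>R k \<in> A"
      using set_plus_intro[OF a] assms(9) by blast
    moreover have "a + 2 *\<^sub>R k \<noteq> a"
      using k(2) by simp
    ultimately have "(1/2) *\<^sub>R a + (1/2) *\<^sub>R (a + 2 *\<^sub>R k) \<in> top_of_set K interior_of A"
      using midpoint a by metis
    moreover have "(1/2) *\<^sub>R a + (1/2) *\<^sub>R (a + 2 *\<^sub>R k) = (1/2) *\<^sub>R (a + a) + k"
      by (simp only: scaleR_add_right scaleR_scaleR) simp
    then have "(1/2) *\<^sub>R a + (1/2) *\<^sub>R (a + 2 *\<^sub>R k) = x"
      using scaleR_half_double[of a] x by simp
    ultimately show "x \<in> top_of_set K interior_of A" by simp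
  qed
  ultimately show ?thesis by blast
qed

end
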